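(* Let $d, r \in \mathbb{N}$, let $\gamma > r^{-1/3}$ and let $X \subseteq \mathbb{R}^d$ be a finite set with $\operatorname{rank}(X) \ge r$. There exists $T \subseteq X$ such that $|T| \le 4(r + 1)/\gamma$ and $$|X + T| \ge (1 - 5\gamma) \frac{(r + 1)|X|}{2}.$$
   Context: For a set $X \subseteq \mathbb{R}^d$, $\operatorname{rank}(X)$ is the minimum dimension of an affine subspace (hyperplane) of $\mathbb{R}^d$ containing $X$. For sets $A, B$ in an abelian group, $A + B = \{a + b : a \in A, b \in B\}$. *)

theory Defs
  imports "HOL-Analysis.Analysis"
begin

text \<open>An affine subspace of dimension \<open>n\<close> (a natural number) is nonempty, since
  \<open>aff_dim {} = -1\<close>; in particular the rank of the empty set is \<open>0\<close>.\<close>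

definition affine_rank :: "'a::euclidean_space set \<Rightarrow> nat" where
  "affine_rank X = (LEAST n. \<exists>S. affine S \<and> X \<subseteq> S \<and> aff_dim S = int n)"

lemma affine_rank_eq_aff_dim:
  fixes X :: "'a::euclidean_space set"
  assumes "X \<noteq> {}"
  shows "int (affine_rank X) = aff_dim X"
proof -
  have nonneg: "0 \<le> aff_dim X"
    using assms aff_dim_negative_iff linorder_not_le by blast
  have "affine_rank X = nat (aff_dim X)"
    unfolding affine_rank_def
  proof (rule Least_equality)
    show "\<exists>S. affine S \<and> X \<subseteq> S \<and> aff_dim S = int (nat (aff_dim X))"
      by (rule exI[of _ "affine hull X"]) (simp add: nonneg hull_subset)
  next
    fix n assume "\<exists>S. affine S \<and> X \<subseteq> S \<and> aff_dim S = int n"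
    then have "aff_dim X \<le> int n"
      using aff_dim_subset by metis
    then show "nat (aff_dim X) \<le> n" by simp
  qed
  then show ?thesis using nonneg by simp
qed

end

theory Submission
  imports Defs
begin

text \<open>
  Assume \<open>0 \<in> X\<close>, \<open>\<gamma> < 1/5\<close> and let \<open>n = \<bar>X\<bar>\<close>. Build \<open>T\<close> greedily, one independent point at a time, and call
  the intersections of \<open>X\<close> with the cosets of \<open>V = span T\<close> classes. Adding an extreme point \<open>b\<close> of \<open>X\<close> modulo
  \<open>V\<close> in some direction, or the opposite extreme point, moves half of \<open>X - V\<close> outside \<open>X + V\<close>, so each step
  gains about \<open>n/2\<close> as long as the class of 0 is small. All classes are kept of size at most \<open>\<gamma>n/8\<close>. By a
  pair count, at most \<open>1/\<gamma>\<^sup>2\<close> extensions of \<open>V\<close> create a class of more than \<open>2\<gamma>n\<close> points, and \<open>b\<close> can be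
  chosen outside their span unless \<open>dim V > r - 1/\<gamma>\<^sup>2 - 2\<close>; since \<open>1/\<gamma>\<^sup>2 < \<gamma>r\<close>, the bound has been reached in
  that case.

  Otherwise some step produces a class of size between \<open>\<gamma>n/8\<close> and \<open>2\<gamma>n\<close>. If there are more than
  \<open>(4/\<gamma> - 1)(r + 1)\<close> classes, the translates of this class by representatives of that many classes suffice.
  If not, adjoin to \<open>T\<close> a representative of each class: a Freiman-type inequality for the quotient, applied to
  the level sets of the class sizes, shows that the new sums outside \<open>X + V\<close> number at least
  \<open>(1 - 2\<gamma>)n/2\<close> for each of the remaining dimensions.
\<close>

section \<open>Fresh translates\<close>

lemma ex_orthogonal_pos:
  fixes y :: "'a::euclidean_space"
  assumes "subspace V" "y \<notin> V"
  obtains w where "\<And>v. v \<in> V \<Longrightarrow> w \<bullet> v = 0" "w \<bullet> y > 0"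
proof -
  obtain v w where *: "v \<in> span V" "\<And>u. u \<in> span V \<Longrightarrow> orthogonal w u" "y = v + w"
    using orthogonal_subspace_decomp_exists[of V y] by metis
  have "w \<noteq> 0" using * assms by (metis add.right_neutral span_eq_iff)
  moreover have "w \<bullet> y = w \<bullet> w" using * by (simp add: inner_right_distrib orthogonal_def)
  ultimately show ?thesis using * that[of w] by (simp add: orthogonal_def span_base)
qed

text \<open>A vector good for \<open>F\<close> is perturbed along a normal \<open>w\<close> that is
  nonzero at the new point \<open>y\<close>; only finitely many multiples \<open>t\<close> create a
  zero.\<close>

lemma ex_orthogonal_nonzero:
  fixes V :: "'a::euclidean_space set"
  assumes "subspace V" "finite F" "F \<inter> V = {}"
  shows "\<exists>q. (\<forall>v\<in>V. q \<bullet> v = 0) \<and> (\<forall>y\<in>F. q \<bullet> y \<noteq> 0)"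
  using assms(2,3)
proof (induction F)
  case empty
  then show ?case by (intro exI[of _ 0]) auto
next
  case (insert y F)
  then obtain q where q: "\<And>v. v \<in> V \<Longrightarrow> q \<bullet> v = 0" "\<And>y. y \<in> F \<Longrightarrow> q \<bullet> y \<noteq> 0" by auto
  obtain w where w: "\<And>v. v \<in> V \<Longrightarrow> w \<bullet> v = 0" "w \<bullet> y > 0"
    using ex_orthogonal_pos[OF assms(1), of y] insert by blast
  have "finite ((\<lambda>z. - (q \<bullet> z) / (w \<bullet> z)) ` insert y F \<union> {0})" using insert by simp
  then obtain t where t: "t \<notin> (\<lambda>z. - (q \<bullet> z) / (w \<bullet> z)) ` insert y F \<union> {0}"
    using ex_new_if_finite[OF infinite_UNIV_char_0] by blast
  have t: "q \<bullet> z + t * (w \<bullet> z) \<noteq> 0" if "z \<in> insert y F" "w \<bullet> z \<noteq> 0" for z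
    using t that by (smt (verit) UnI1 image_eqI nonzero_mult_div_cancel_right)
  have "(q + t *\<^sub>R w) \<bullet> z \<noteq> 0" if z: "z \<in> insert y F" for z
  proof (cases "w \<bullet> z = 0")
    case True
    then show ?thesis using z w q by (auto simp: inner_left_distrib)
  next
    case False
    then show ?thesis using t z by (simp add: inner_left_distrib)
  qed
  then show ?case using q w by (intro exI[of _ "q + t *\<^sub>R w"]) (auto simp: inner_left_distrib)
qed

text \<open>If \<open>y + b - x\<close> were in \<open>V\<close>, the
  \<open>(p, q)\<close>-coordinates of \<open>x\<close> would be the sum of those of
  \<open>y\<close> and \<open>b\<close>, so \<open>x\<close> would beat the lexicographic maximiser
  \<open>b\<close>. The point \<open>b\<close> avoids \<open>W\<close> because \<open>p\<close>
  vanishes on \<open>W\<close> and is positive at \<open>b\<close>.\<close>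

lemma lex_max_fresh:
  fixes X :: "'a::euclidean_space set"
  assumes "finite X" and p: "\<And>v. v \<in> W \<Longrightarrow> p \<bullet> v = 0" and "V \<subseteq> W"
    and q: "\<And>v. v \<in> V \<Longrightarrow> q \<bullet> v = 0" and u: "u \<in> X" "p \<bullet> u > 0"
  shows "\<exists>b\<in>X - W. {y \<in> X. p \<bullet> y > 0 \<or> p \<bullet> y = 0 \<and> q \<bullet> y > 0} \<subseteq> {y \<in> X. \<forall>x\<in>X. y + b - x \<notin> V}"
proof -
  define m where "m = Max ((\<bullet>) p ` X)"
  have m: "p \<bullet> x \<le> m" if "x \<in> X" for x using that assms(1) by (simp add: m_def)
  define X' where "X' = {x \<in> X. p \<bullet> x = m}"
  have "m \<in> (\<bullet>) p ` X" unfolding m_def using assms(1) u by (intro Max_in) auto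
  then have "X' \<noteq> {}" "finite X'" using assms(1) by (auto simp: X'_def)
  then obtain b where b: "b \<in> X'" "\<And>x. x \<in> X' \<Longrightarrow> q \<bullet> x \<le> q \<bullet> b"
    using ex_is_arg_min_if_finite[of X' "\<lambda>x. - (q \<bullet> x)"] by (auto simp: is_arg_min_linorder)
  have "m > 0" using m u by force
  then have "b \<in> X - W" using b p by (auto simp: X'_def)
  moreover have "y + b - x \<notin> V"
    if y: "y \<in> X" "p \<bullet> y > 0 \<or> p \<bullet> y = 0 \<and> q \<bullet> y > 0" "x \<in> X" for x y
  proof
    assume "y + b - x \<in> V"
    then have "p \<bullet> x = p \<bullet> y + p \<bullet> b" "q \<bullet> x = q \<bullet> y + q \<bullet> b"
      using p[of "y + b - x"] q[of "y + b - x"] \<open>V \<subseteq> W\<close>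
      by (auto simp: inner_add_right inner_diff_right)
    then show False using y m[of x] b(1) b(2)[of x] by (auto simp: X'_def)
  qed
  ultimately show ?thesis by blast
qed

text \<open>The functional \<open>p\<close> vanishes on \<open>W\<close> and takes both signs on \<open>X\<close>. A lexicographic maximiser
  \<open>b\<close> for \<open>(p, q)\<close> makes \<open>y + b\<close> fresh for every lexicographically positive \<open>y\<close>, a minimiser does so for
  every negative \<open>y\<close>; one of the two halves has at least half of the points outside \<open>V\<close>.\<close>

lemma ex_half_fresh:
  fixes X :: "'a::euclidean_space set"
  assumes "finite X" "subspace V" "subspace W" "V \<subseteq> W" "dim W + 2 \<le> dim X"
  shows "\<exists>b\<in>X - W. card X \<le> card (X \<inter> V) + 2 * card {y \<in> X. \<forall>x\<in>X. y + b - x \<notin> V}"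
proof -
  have "\<not> X \<subseteq> W" using dim_subset[of X W] assms by auto
  then obtain u where u: "u \<in> X" "u \<notin> W" by blast
  have "dim (insert u W) \<le> dim W + 1" by (simp add: dim_insert)
  then have "\<not> X \<subseteq> span (insert u W)"
    using dim_subset[of X "span (insert u W)"] assms by auto
  then obtain v where v: "v \<in> X" "v \<notin> span (insert u W)" by blast
  obtain w1 where w1: "\<And>x. x \<in> W \<Longrightarrow> w1 \<bullet> x = 0" "w1 \<bullet> u > 0"
    using ex_orthogonal_pos[OF assms(3) u(2)] by blast
  obtain w2 where w2: "\<And>x. x \<in> span (insert u W) \<Longrightarrow> w2 \<bullet> x = 0" "w2 \<bullet> v > 0"
    using ex_orthogonal_pos[OF subspace_span v(2)] by blast
  \<comment> \<open>Since \<open>w2\<close> kills \<open>W\<close> and \<open>u\<close>, this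
    combination keeps \<open>p \<bullet> u\<close> equal to \<open>w1 \<bullet> u\<close> and makes
    \<open>p \<bullet> v\<close> equal to -1. It needs \<open>u\<close> and \<open>v\<close>
    independent modulo \<open>W\<close>, hence the two spare dimensions.\<close>
  define p where "p = w1 - ((w1 \<bullet> v + 1) / (w2 \<bullet> v)) *\<^sub>R w2"
  have p: "p \<bullet> x = 0" if "x \<in> W" for x
    using that w1 w2(1)[of x] by (simp add: p_def inner_diff_left span_base)
  have pu: "p \<bullet> u > 0" using w1 w2(1)[of u] by (simp add: p_def inner_diff_left span_base)
  have pv: "p \<bullet> v < 0" using w2(2) by (simp add: p_def inner_diff_left)
  \<comment> \<open>\<open>q\<close> breaks the ties \<open>p \<bullet> y = 0\<close>, so that every
    point of \<open>X - V\<close> lands in \<open>P\<close> or \<open>Q\<close>.\<close>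
  obtain q where q: "\<And>x. x \<in> V \<Longrightarrow> q \<bullet> x = 0" "\<And>y. y \<in> X - V \<Longrightarrow> q \<bullet> y \<noteq> 0"
    using ex_orthogonal_nonzero[OF assms(2), of "X - V"] assms(1) by (metis Diff_disjoint Int_commute finite_Diff)
  define P where "P = {y \<in> X. p \<bullet> y > 0 \<or> p \<bullet> y = 0 \<and> q \<bullet> y > 0}"
  define Q where "Q = {y \<in> X. (-p) \<bullet> y > 0 \<or> (-p) \<bullet> y = 0 \<and> (-q) \<bullet> y > 0}"
  let ?F = "\<lambda>b. {y \<in> X. \<forall>x\<in>X. y + b - x \<notin> V}"
  obtain b where b: "b \<in> X - W" "P \<subseteq> ?F b"
    using lex_max_fresh[of X W p V q u] assms p q u pu unfolding P_def by blast
  obtain a where a: "a \<in> X - W" "Q \<subseteq> ?F a"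
    using lex_max_fresh[of X W "-p" V "-q" v] assms p q v pv unfolding Q_def by auto
  have "X \<subseteq> (X \<inter> V) \<union> (P \<union> Q)" using q(2) by (force simp: P_def Q_def)
  then have "card X \<le> card ((X \<inter> V) \<union> (P \<union> Q))"
    by (intro card_mono) (auto simp: assms(1) P_def Q_def)
  also have "\<dots> \<le> card (X \<inter> V) + (card P + card Q)"
    by (intro order_trans[OF card_Un_le] add_mono card_Un_le order_refl)
  also have "card P \<le> card (?F b)" using b assms(1) by (intro card_mono) auto
  also have "card Q \<le> card (?F a)" using a assms(1) by (intro card_mono) auto
  finally have "card X \<le> card (X \<inter> V) + (card (?F b) + card (?F a))" by simp
  then consider "card X \<le> card (X \<inter> V) + 2 * card (?F b)" | "card X \<le> card (X \<inter> V) + 2 * card (?F a)"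
    by linarith
  then show ?thesis using a b by cases blast+
qed

section \<open>Heavy extensions of a subspace\<close>

lemma span_insert_exchange:
  assumes "c \<in> span (insert b V)" "c \<notin> span V"
  shows "span (insert c V) = span (insert (b::'a::real_vector) V)"
proof -
  have "b \<in> span (insert c V)" using in_span_insert[OF assms] .
  then show ?thesis using assms
    by (intro equalityI span_minimal) (auto intro: span_base)
qed

text \<open>A subspace spanned by \<open>V\<close> and one more point is determined by any pair of points whose difference it
  contains but \<open>V\<close> does not. A heavy coset owns at least \<open>s * (s - t)\<close> such ordered pairs, so counting pairs
  bounds the number of heavy extensions; \<open>W\<close> is the span of all of them.\<close>

lemma few_heavy_extensions:
  fixes X :: "'a::euclidean_space set" and s t :: real
  assumes "finite X" "subspace V" "0 \<le> t" "t < s"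
    and cls: "\<And>z. z \<in> X \<Longrightarrow> real (card {x \<in> X. x - z \<in> V}) \<le> t"
  obtains W where "subspace W" "V \<subseteq> W" "real (dim W) \<le> real (dim V) + real (card X)^2 / (s * (s - t))"
    "\<And>b z. \<lbrakk>b \<in> X - W; z \<in> X\<rbrakk> \<Longrightarrow> real (card {x \<in> X. x - z \<in> span (insert b V)}) \<le> s"
proof -
  define Bad where "Bad = {b \<in> X - V. \<exists>z\<in>X. real (card {x \<in> X. x - z \<in> span (insert b V)}) > s}"
  define H where "H = (\<lambda>b. span (insert b V)) ` Bad"
  define P where "P L = {(x, y) \<in> X \<times> X. x - y \<in> L \<and> x - y \<notin> V}" for L
  have spV: "span V = V" using assms(2) by (simp add: span_eq_iff)
  have finH: "finite H" using assms(1) by (simp add: H_def Bad_def)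
  have finP: "finite (P L)" for L
    by (rule finite_subset[of _ "X \<times> X"]) (auto simp: P_def assms(1))
  have L_eq: "L = span (insert (x - y) V)" if "L \<in> H" "(x, y) \<in> P L" for L x y
    using that span_insert_exchange[of "x - y" _ V] spV by (auto simp: H_def P_def)
  have card_P: "s * (s - t) \<le> real (card (P L))" if L: "L \<in> H" for L
  proof -
    obtain b z where b: "z \<in> X" "L = span (insert b V)" "real (card {x \<in> X. x - z \<in> L}) > s"
      using L by (auto simp: H_def Bad_def)
    define C where "C = {x \<in> X. x - z \<in> L}"
    \<comment> \<open>Each \<open>x\<close> in the heavy class \<open>C\<close> shares its
      \<open>V\<close>-class with at most \<open>t\<close> points, which leaves at least
      \<open>s - t\<close> partners in \<open>C\<close>.\<close>
    have "(SIGMA x:C. C - {y \<in> X. y - x \<in> V}) \<subseteq> P L"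
    proof
      fix e assume "e \<in> (SIGMA x:C. C - {y \<in> X. y - x \<in> V})"
      then obtain x y where *: "e = (x, y)" "x \<in> C" "y \<in> C" "y \<notin> {y \<in> X. y - x \<in> V}"
        by blast
      then have "x - z \<in> span (insert b V)" "y - z \<in> span (insert b V)" using b(2) by (auto simp: C_def)
      then have "(x - z) - (y - z) \<in> L" unfolding b(2) by (rule span_diff)
      moreover have "x - y \<notin> V"
        using * subspace_neg[OF assms(2), of "x - y"] by (auto simp: C_def)
      ultimately show "e \<in> P L" using * by (auto simp: P_def C_def)
    qed
    then have "card (SIGMA x:C. C - {y \<in> X. y - x \<in> V}) \<le> card (P L)"
      by (intro card_mono finP)
    moreover have "card (SIGMA x:C. C - {y \<in> X. y - x \<in> V}) = (\<Sum>x\<in>C. card (C - {y \<in> X. y - x \<in> V}))"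
      using assms(1) by (intro card_SigmaI) (auto simp: C_def)
    moreover have "real (\<Sum>x\<in>C. card (C - {y \<in> X. y - x \<in> V})) \<ge> (\<Sum>x\<in>C. s - t)"
      unfolding of_nat_sum
    proof (rule sum_mono)
      fix x assume x: "x \<in> C"
      have "card C - card {y \<in> X. y - x \<in> V} \<le> card (C - {y \<in> X. y - x \<in> V})"
        using assms(1) by (intro diff_card_le_card_Diff) auto
      moreover have "real (card {y \<in> X. y - x \<in> V}) \<le> t" using x cls by (auto simp: C_def)
      ultimately show "s - t \<le> real (card (C - {y \<in> X. y - x \<in> V}))"
        using b(3) by (simp add: C_def)
    qed
    moreover have "(\<Sum>x\<in>C. s - t) \<ge> s * (s - t)"
      using b(3) assms(4) by (auto simp: C_def intro: mult_right_mono)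
    ultimately show ?thesis by linarith
  qed
  have disj: "P L \<inter> P L' = {}" if "L \<in> H" "L' \<in> H" "L \<noteq> L'" for L L'
    using that L_eq by (metis disjoint_iff surj_pair)
  have "(\<Sum>L\<in>H. card (P L)) = card (\<Union>L\<in>H. P L)"
    using finH finP disj by (intro card_UN_disjoint[symmetric]) auto
  also have "\<dots> \<le> card (X \<times> X)" using assms(1) by (intro card_mono) (auto simp: P_def)
  finally have "real (\<Sum>L\<in>H. card (P L)) \<le> real (card X)^2"
    by (simp only: card_cartesian_product power2_eq_square of_nat_mult[symmetric] of_nat_le_iff)
  moreover have "(\<Sum>L\<in>H. s * (s - t)) \<le> real (\<Sum>L\<in>H. card (P L))"
    unfolding of_nat_sum by (intro sum_mono card_P)
  ultimately have "real (card H) * (s * (s - t)) \<le> real (card X)^2" by simp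
  then have cardH: "real (card H) \<le> real (card X)^2 / (s * (s - t))"
    using assms by (simp add: field_simps)
  \<comment> \<open>One generator per heavy extension is added to a basis of \<open>V\<close>, so
    the dimension grows by at most \<open>card H\<close>.\<close>
  have "\<forall>L\<in>H. \<exists>b. L = span (insert b V)" by (auto simp: H_def)
  then obtain f where f: "\<And>L. L \<in> H \<Longrightarrow> L = span (insert (f L) V)" by metis
  obtain B where B: "B \<subseteq> V" "independent B" "V \<subseteq> span B" "card B = dim V"
    using basis_exists by blast
  have finB: "finite B" using B(2) by (rule independent_imp_finite)
  have VW: "V \<subseteq> span (B \<union> f ` H)" using B(3) span_mono[of B "B \<union> f ` H"] by auto
  show ?thesis
  proof (rule that[of "span (B \<union> f ` H)"])
    show "subspace (span (B \<union> f ` H))" by simp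
    show "V \<subseteq> span (B \<union> f ` H)" by fact
    have "dim (span (B \<union> f ` H)) \<le> card (B \<union> f ` H)"
      using finB finH by (simp add: dim_le_card')
    also have "\<dots> \<le> card B + card H"
      by (intro order_trans[OF card_Un_le] add_mono order_refl card_image_le finH)
    finally show "real (dim (span (B \<union> f ` H))) \<le> real (dim V) + real (card X)^2 / (s * (s - t))"
      using cardH B(4) by linarith
    fix b z assume bz: "b \<in> X - span (B \<union> f ` H)" "z \<in> X"
    show "real (card {x \<in> X. x - z \<in> span (insert b V)}) \<le> s"
    proof (rule ccontr)
      assume "\<not> ?thesis"
      then have "b \<in> Bad" using bz VW by (auto simp: Bad_def not_le)
      then have "span (insert b V) \<in> H" by (auto simp: H_def)
      then have "b \<in> span (insert (f (span (insert b V))) V)"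
        using f[of "span (insert b V)"] span_base[of b "insert b V"] by simp
      also have "\<dots> \<subseteq> span (B \<union> f ` H)"
        using VW \<open>span (insert b V) \<in> H\<close> by (intro span_minimal) (auto intro: span_base)
      finally show False using bz by simp
    qed
  qed
qed

section \<open>A Freiman-type inequality\<close>

text \<open>If \<open>\<psi>\<close> vanishes on the fresh neighbours, a point \<open>w\<close> of maximal slope \<open>\<psi> / \<phi>\<close>, as close to \<open>v\<close> as
  possible in the sense of \<open>\<phi>\<close>, cannot satisfy \<open>v + w = a + u\<close>: both summands would have the same
  maximal slope and \<open>a\<close> would be closer.\<close>

lemma fresh_neighbours_span:
  fixes A :: "'a::euclidean_space set"
  assumes "finite A" and p: "\<And>x. x \<in> A \<Longrightarrow> p \<bullet> x < p \<bullet> v"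
  shows "A \<subseteq> affine hull (insert v {w \<in> A. v + w \<notin> A + A})"
proof
  fix w0 assume w0: "w0 \<in> A"
  let ?F = "{w \<in> A. v + w \<notin> A + A}"
  define V where "V = span ((\<lambda>x. - v + x) ` ?F)"
  have hull: "affine hull (insert v ?F) = (\<lambda>x. v + x) ` V"
    unfolding V_def by (rule affine_hull_insert_span_gen)
  show "w0 \<in> affine hull (insert v ?F)"
  proof (rule ccontr)
    assume "\<not> ?thesis"
    then have "w0 - v \<notin> V" unfolding hull by (metis add.commute diff_add_cancel imageI)
    then obtain q where q: "\<And>x. x \<in> V \<Longrightarrow> q \<bullet> x = 0" "q \<bullet> (w0 - v) > 0"
      using ex_orthogonal_pos[of V] by (auto simp: V_def)
    define \<phi> where "\<phi> x = p \<bullet> (v - x)" for x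
    define \<psi> where "\<psi> x = q \<bullet> (x - v)" for x
    have \<phi>: "\<phi> x > 0" if "x \<in> A" for x using p[OF that] by (simp add: \<phi>_def inner_diff_right)
    define m where "m = Max ((\<lambda>x. \<psi> x / \<phi> x) ` A)"
    have "\<psi> x / \<phi> x \<le> m" if "x \<in> A" for x using that assms(1) by (simp add: m_def)
    then have m: "\<psi> x \<le> m * \<phi> x" if "x \<in> A" for x using that \<phi> by (simp add: pos_divide_le_eq)
    have "\<psi> w0 > 0" using q by (simp add: \<psi>_def)
    then have "m > 0" using m[OF w0] \<phi>[OF w0] by (smt (verit) zero_less_mult_pos2)
    define A' where "A' = {x \<in> A. \<psi> x = m * \<phi> x}"
    have "m \<in> (\<lambda>x. \<psi> x / \<phi> x) ` A" unfolding m_def using assms(1) w0 by (intro Max_in) auto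
    then have "A' \<noteq> {}" using \<phi> by (fastforce simp: A'_def)
    then obtain w where w: "w \<in> A'" "\<And>x. x \<in> A' \<Longrightarrow> \<phi> w \<le> \<phi> x"
      using ex_is_arg_min_if_finite[of A' \<phi>] assms(1) by (auto simp: A'_def is_arg_min_linorder)
    have "\<psi> w > 0" using w \<phi> \<open>m > 0\<close> by (simp add: A'_def)
    then have "w \<notin> ?F" using q(1)[of "- v + w"] by (force simp: \<psi>_def V_def intro: span_base)
    then have "v + w \<in> A + A" using w by (simp add: A'_def)
    then obtain a u where au: "a \<in> A" "u \<in> A" "v + w = a + u" by (auto elim: set_plus_elim)
    \<comment> \<open>With \<open>v\<close> as origin the relation becomes a sum, on which
      \<open>\<phi>\<close> and \<open>\<psi>\<close> are additive.\<close>
    then have *: "w - v = (a - v) + (u - v)" "v - w = (v - a) + (v - u)"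
      by (simp_all add: algebra_simps)
    have "\<phi> w = \<phi> a + \<phi> u" "\<psi> w = \<psi> a + \<psi> u"
      unfolding \<phi>_def \<psi>_def *(1) by (simp_all add: *(2) inner_add_right)
    moreover have "\<psi> w = m * \<phi> w" using w by (simp add: A'_def)
    ultimately have "\<psi> a = m * \<phi> a" using m[of a] m[of u] au by (simp add: algebra_simps)
    then have "\<phi> w \<le> \<phi> a" using au w(2) by (simp add: A'_def)
    then show False using \<open>\<phi> w = \<phi> a + \<phi> u\<close> \<phi>[of u] au by simp
  qed
qed

text \<open>A Freiman-type inequality, weaker than Ruzsa's \<open>\<bar>A + U\<bar> \<ge> \<bar>A\<bar> + m\<bar>U\<bar> - m(m+1)/2\<close> in general, but
  valid for every nonempty \<open>U\<close>.  The induction removes the vertex \<open>v\<close> of largest norm.\<close>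

lemma card_sumset_subset_ge:
  fixes A U :: "'a::euclidean_space set"
  assumes "finite A" "U \<subseteq> A" "U \<noteq> {}"
  shows "2 * int (card A) + aff_dim A * (int (card U) - 1) \<le> 2 * int (card (A + U))"
  using assms
proof (induction "card A" arbitrary: A U rule: less_induct)
  case less
  have finU: "finite U" using less.prems finite_subset by blast
  obtain v where v: "v \<in> A" "\<And>x. x \<in> A \<Longrightarrow> norm x \<le> norm v"
    using less.prems ex_is_arg_min_if_finite[of A "\<lambda>x. - norm x"]
    by (auto simp: is_arg_min_linorder)
  define A' U' where "A' = A - {v}" and "U' = U - {v}"
  \<comment> \<open>Maximality of the norm gives only a weak bound on \<open>norm x\<close>;
    strictness comes from \<open>v - x\<close> being nonzero.\<close>
  have p: "v \<bullet> x < v \<bullet> v" if "x \<in> A'" for x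
  proof -
    have "(norm (v - x))\<^sup>2 > 0" using that by (auto simp: A'_def)
    moreover have "(norm x)\<^sup>2 \<le> (norm v)\<^sup>2" using that v by (auto simp: A'_def intro: power_mono)
    ultimately show ?thesis
      by (simp add: power2_norm_eq_inner inner_diff inner_commute)
  qed
  have fin: "finite A'" "finite U'" using less.prems finU by (auto simp: A'_def U'_def)
  have A: "A = insert v A'" "v \<notin> A'" using v by (auto simp: A'_def)
  have cardA: "card A = Suc (card A')" using A fin by simp
  have "U' \<subseteq> A'" using less.prems by (auto simp: A'_def U'_def)
  have IH: "2 * int (card A') + aff_dim A' * (int (card W) - 1) \<le> 2 * int (card (A' + W))"
    if "W \<subseteq> A'" "W \<noteq> {}" for W
    using less.hyps[of A' W] cardA fin that by simp
  have finAU: "finite (A + U)" using less.prems(1) finU by (rule finite_set_plus)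
  show ?case
  \<comment> \<open>Singletons are treated apart so that \<open>U - {v}\<close> stays nonempty when
    the induction hypothesis is applied to it.\<close>
  proof (cases "card U = 1")
    case True
    then obtain u where "U = {u}" by (rule card_1_singletonE)
    then have "A + U = (\<lambda>x. x + u) ` A" by (auto simp: set_plus_def)
    then show ?thesis using True by (simp add: card_image)
  next
    case False
    then have cardU: "card U \<ge> 2" using card_gt_0_iff[of U] less.prems finU by linarith
    have "U' \<noteq> {}"
    proof
      assume "U' = {}"
      then have "U \<subseteq> {v}" by (auto simp: U'_def)
      then have "card U \<le> card {v}" by (intro card_mono) auto
      then show False using cardU by simp
    qed
    have "A' \<noteq> {}" using \<open>U' \<noteq> {}\<close> \<open>U' \<subseteq> A'\<close> by blast
    have "aff_dim A' \<ge> 0" using \<open>A' \<noteq> {}\<close> using aff_dim_negative_iff[of A'] by linarith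
    have aff: "a + b - c \<in> affine hull A'" if "a \<in> A'" "b \<in> A'" "c \<in> A'" for a b c
      using that mem_affine_3_minus[OF affine_affine_hull, of a A' b c 1] hull_inc[of _ A' affine]
      by (simp add: algebra_simps)
    show ?thesis
    proof (cases "v \<in> U")
      case vU: True
      then have U: "U = insert v U'" "card U = Suc (card U')"
        using finU card_Suc_Diff1[of U v] by (auto simp: U'_def)
      have sub: "A' + U' \<subseteq> A + U" using A U by (intro set_plus_mono2) auto
      have vA: "v + w \<in> A + U" if "w \<in> A" for w
        using set_plus_intro[OF that vU] by (simp add: add.commute)
      show ?thesis
      proof (cases "v \<in> affine hull A'")
        case True
        then have dim: "aff_dim A = aff_dim A'" using A by (simp add: aff_dim_insert)
        \<comment> \<open>The sums \<open>v + w\<close> with \<open>w\<close> in \<open>F\<close>,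
          and \<open>v + v\<close>, are new. By the spanning lemma \<open>F\<close> and
          \<open>v\<close> affinely span \<open>A\<close>, so \<open>F\<close> has at least
          \<open>aff_dim A\<close> points.\<close>
        define F where "F = {w \<in> A'. v + w \<notin> A' + A'}"
        have "finite F" using fin by (simp add: F_def)
        have "A \<subseteq> affine hull (insert v F)"
          using fresh_neighbours_span[of A' v v] fin p A by (auto simp: F_def hull_inc)
        then have "aff_dim A \<le> aff_dim (insert v F)"
          by (metis aff_dim_subset aff_dim_affine_hull)
        also have "\<dots> \<le> int (card (insert v F)) - 1"
          using \<open>finite F\<close> by (intro aff_dim_le_card) auto
        also have "\<dots> \<le> int (card F)" using \<open>finite F\<close> by (simp add: card_insert_if)
        finally have F: "aff_dim A \<le> int (card F)" .
        have "v + v \<notin> A' + A'"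
        proof
          assume "v + v \<in> A' + A'"
          then obtain a b where "a \<in> A'" "b \<in> A'" "v + v = a + b" by (auto elim: set_plus_elim)
          then have "v \<bullet> v + v \<bullet> v = v \<bullet> a + v \<bullet> b" by (metis inner_add_right)
          then show False using p[of a] p[of b] \<open>a \<in> A'\<close> \<open>b \<in> A'\<close> by simp
        qed
        moreover have "A' + U' \<subseteq> A' + A'" using \<open>U' \<subseteq> A'\<close> by (intro set_plus_mono2) auto
        ultimately have disj: "(A' + U') \<inter> (\<lambda>w. v + w) ` insert v F = {}"
          by (auto simp: F_def)
        have "(A' + U') \<union> (\<lambda>w. v + w) ` insert v F \<subseteq> A + U"
          using sub vA A by (auto simp: F_def)
        then have "card ((A' + U') \<union> (\<lambda>w. v + w) ` insert v F) \<le> card (A + U)"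
          by (rule card_mono[OF finAU])
        moreover have "card ((A' + U') \<union> (\<lambda>w. v + w) ` insert v F) = card (A' + U') + card (insert v F)"
          using disj fin \<open>finite F\<close>
          by (subst card_Un_disjoint) (auto simp: finite_set_plus card_image[OF inj_on_add] simp del: image_insert)
        moreover have "card (insert v F) = Suc (card F)"
          using \<open>finite F\<close> A(2) by (simp add: F_def)
        ultimately have "card (A' + U') + card F + 1 \<le> card (A + U)" by simp
        then show ?thesis
          using IH[OF \<open>U' \<subseteq> A'\<close> \<open>U' \<noteq> {}\<close>] F U(2) cardA dim by (simp add: algebra_simps)
      next
        case False
        then have dim: "aff_dim A = aff_dim A' + 1" using A by (simp add: aff_dim_insert)
        \<comment> \<open>All \<open>card A\<close> translates \<open>v + w\<close> are new: for
          \<open>w\<close> in \<open>A'\<close> because \<open>a + b - w\<close> stays in the hull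
          of \<open>A'\<close>, for \<open>w = v\<close> because \<open>v\<close> is strictly
          extreme in its own direction.\<close>
        have mid: "v + v \<noteq> a + b" if "a \<in> A'" "b \<in> A'" for a b
        proof
          assume "v + v = a + b"
          then have "v \<bullet> v + v \<bullet> v = v \<bullet> a + v \<bullet> b" by (metis inner_add_right)
          then show False using p[of a] p[of b] that by simp
        qed
        have "v + w \<noteq> a + b" if "a \<in> A'" "b \<in> A'" "w \<in> A" for a b w
        proof (cases "w = v")
          case True
          then show ?thesis using mid[OF that(1,2)] by simp
        next
          case False
          then have "a + b - w \<in> affine hull A'" using aff that A by blast
          then show ?thesis using \<open>v \<notin> affine hull A'\<close> by (metis add_diff_cancel_right')
        qed
        then have disj: "(A' + U') \<inter> (\<lambda>w. v + w) ` A = {}"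
          using \<open>U' \<subseteq> A'\<close> by (auto elim!: set_plus_elim) (metis subsetD)
        have "(A' + U') \<union> (\<lambda>w. v + w) ` A \<subseteq> A + U"
          using sub vA by auto
        then have "card ((A' + U') \<union> (\<lambda>w. v + w) ` A) \<le> card (A + U)"
          by (rule card_mono[OF finAU])
        moreover have "card ((A' + U') \<union> (\<lambda>w. v + w) ` A) = card (A' + U') + card A"
          using disj fin less.prems(1)
          by (subst card_Un_disjoint) (auto simp: finite_set_plus card_image)
        ultimately have *: "card (A' + U') + card A \<le> card (A + U)" by simp
        \<comment> \<open>The target exceeds the induction bound by
          \<open>aff_dim A' + card U' + 2\<close>, which these two estimates keep below the gain
          \<open>2 * card A\<close>.\<close>
        have "aff_dim A' \<le> int (card A') - 1" using fin by (intro aff_dim_le_card)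
        moreover have "card U' \<le> card A'" using \<open>U' \<subseteq> A'\<close> fin by (intro card_mono)
        ultimately show ?thesis
          using IH[OF \<open>U' \<subseteq> A'\<close> \<open>U' \<noteq> {}\<close>] * U(2) cardA dim by (simp add: algebra_simps)
      qed
    next
      case vU: False
      then have "U \<subseteq> A'" using less.prems by (auto simp: A'_def)
      \<comment> \<open>If the dimension does not drop, one new sum is enough: \<open>v + u\<close>
        is strictly larger in direction \<open>v\<close> than all of \<open>A' + U\<close>.
        Otherwise all of \<open>v + U\<close> is new.\<close>
      obtain u where u: "u \<in> U" "\<And>x. x \<in> U \<Longrightarrow> v \<bullet> x \<le> v \<bullet> u"
        using less.prems finU ex_is_arg_min_if_finite[of U "\<lambda>x. - (v \<bullet> x)"]
        by (auto simp: is_arg_min_linorder)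
      have sub: "A' + U \<subseteq> A + U" by (intro set_plus_mono2) (auto simp: A)
      show ?thesis
      proof (cases "v \<in> affine hull A'")
        case True
        then have dim: "aff_dim A = aff_dim A'" using A by (simp add: aff_dim_insert)
        have "v + u \<notin> A' + U"
        proof
          assume "v + u \<in> A' + U"
          then obtain a b where ab: "a \<in> A'" "b \<in> U" "v + u = a + b" by (auto elim: set_plus_elim)
          then have "v \<bullet> v + v \<bullet> u = v \<bullet> a + v \<bullet> b" by (metis inner_add_right)
          then show False using p[of a] u(2)[of b] ab by simp
        qed
        moreover have "v + u \<in> A + U" using v u by blast
        ultimately have "A' + U \<subset> A + U" using sub by blast
        then have "card (A' + U) < card (A + U)" by (rule psubset_card_mono[OF finAU])
        then show ?thesis using IH[OF \<open>U \<subseteq> A'\<close> less.prems(3)] dim cardA by simp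
      next
        case False
        then have dim: "aff_dim A = aff_dim A' + 1" using A by (simp add: aff_dim_insert)
        have "v + w \<noteq> a + b" if "a \<in> A'" "b \<in> A'" "w \<in> A'" for a b w
        proof
          assume "v + w = a + b"
          then have "v = a + b - w" by (metis add_diff_cancel_right')
          then show False
            using aff[OF that] False by simp
        qed
        then have disj: "(A' + U) \<inter> (\<lambda>w. v + w) ` U = {}"
          using \<open>U \<subseteq> A'\<close> by (auto elim!: set_plus_elim) (metis subsetD)
        have "(A' + U) \<union> (\<lambda>w. v + w) ` U \<subseteq> A + U" using sub v by auto
        then have "card ((A' + U) \<union> (\<lambda>w. v + w) ` U) \<le> card (A + U)"
          by (rule card_mono[OF finAU])
        moreover have "card ((A' + U) \<union> (\<lambda>w. v + w) ` U) = card (A' + U) + card U"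
          using disj fin finU
          by (subst card_Un_disjoint) (auto simp: finite_set_plus card_image)
        ultimately show ?thesis
          using IH[OF \<open>U \<subseteq> A'\<close> less.prems(3)] dim cardA cardU by (simp add: algebra_simps)
      qed
    qed
  qed
qed

text \<open>The inequality above is applied to the level sets \<open>U t\<close> of the class sizes \<open>\<mu>\<close> and summed over \<open>t\<close>.\<close>

lemma card_new_classes_ge:
  fixes X :: "'a::euclidean_space set" and f :: "'a \<Rightarrow> 'b::euclidean_space"
  assumes "finite X" "linear f" "x0 \<in> X"
    and g: "\<And>x. x \<in> X \<Longrightarrow> g (f x) \<in> X" "\<And>x. x \<in> X \<Longrightarrow> f (g (f x)) = f x"
    and max: "\<And>x. x \<in> X \<Longrightarrow> card {y \<in> X. f y = f x} \<le> card {y \<in> X. f y = f x0}"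
  shows "aff_dim (f ` X) * (int (card X) - int (card {y \<in> X. f y = f x0}))
    \<le> 2 * int (card {z \<in> X + g ` f ` X. f z \<notin> f ` X})"
proof -
  define A where "A = f ` X"
  define \<mu> where "\<mu> a = card {y \<in> X. f y = a}" for a
  \<comment> \<open>With \<open>s\<close> the largest class size, \<open>1..s\<close> are exactly
    the positive levels with \<open>U t\<close> nonempty. Each of them loses 1 in the Freiman-type
    inequality, which produces the term \<open>- s\<close>.\<close>
  define s where "s = \<mu> (f x0)"
  define U where "U t = {a \<in> A. t \<le> \<mu> a}" for t
  define C where "C = (A + A) - A"
  define S where "S c = {z \<in> X + g ` A. f z = c}" for c
  have f_add: "f (x + y) = f x + f y" for x y using assms(2) by (rule linear_add)
  have finA: "finite A" using assms(1) by (simp add: A_def)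
  have finS: "finite (S c)" for c using assms(1) finA by (simp add: S_def finite_set_plus)
  have finC: "finite C" using finA by (simp add: C_def finite_set_plus)
  have \<mu>s: "\<mu> a \<le> s" if "a \<in> A" for a using that max by (auto simp: A_def \<mu>_def s_def)
  have level: "t \<le> card (S c)" if "c \<in> U t + A" for c t
  proof -
    obtain a b where ab: "a \<in> A" "t \<le> \<mu> a" "b \<in> A" "c = a + b"
      using \<open>c \<in> U t + A\<close> by (auto simp: U_def elim: set_plus_elim)
    have "(\<lambda>y. y + g b) ` {y \<in> X. f y = a} \<subseteq> S c"
      using ab g(2) by (auto simp: S_def A_def f_add)
    then have "card ((\<lambda>y. y + g b) ` {y \<in> X. f y = a}) \<le> card (S c)"
      by (rule card_mono[OF finS])
    then show ?thesis using ab by (simp add: card_image \<mu>_def)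
  qed
  have "{z \<in> X + g ` A. f z \<notin> A} = (\<Union>c\<in>C. S c)"
  proof -
    have "f z \<in> A + A" if "z \<in> X + g ` A" for z
    proof -
      obtain x y where "x \<in> X" "y \<in> X" "z = x + g (f y)"
        using \<open>z \<in> X + g ` A\<close> by (auto simp: A_def elim!: set_plus_elim)
      then show ?thesis using g(2) by (auto simp: A_def f_add)
    qed
    then show ?thesis by (auto simp: S_def C_def)
  qed
  moreover have "card (\<Union>c\<in>C. S c) = (\<Sum>c\<in>C. card (S c))"
    using finC finS by (intro card_UN_disjoint) (auto simp: S_def)
  ultimately have "card {z \<in> X + g ` A. f z \<notin> A} = (\<Sum>c\<in>C. card (S c))" by simp
  \<comment> \<open>The fibre over \<open>c\<close> is at least as large as any level
    \<open>t\<close> with \<open>c\<close> in \<open>U t + A\<close>, hence as the number of such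
    levels.\<close>
  also have "\<dots> \<ge> (\<Sum>c\<in>C. card {t \<in> {1..s}. c \<in> U t + A})"
  proof (rule sum_mono)
    fix c
    have "card {t \<in> {1..s}. c \<in> U t + A} \<le> card {1..card (S c)}"
      using level by (intro card_mono) auto
    then show "card {t \<in> {1..s}. c \<in> U t + A} \<le> card (S c)" by simp
  qed
  finally have le: "(\<Sum>c\<in>C. card {t \<in> {1..s}. c \<in> U t + A}) \<le> card {z \<in> X + g ` A. f z \<notin> A}" .
  have "(\<Sum>c\<in>C. card {t \<in> {1..s}. c \<in> U t + A}) = (\<Sum>t=1..s. card {c \<in> C. c \<in> U t + A})"
    using sum.swap_restrict[OF finC, of "{1..s}" "\<lambda>_ _. 1::nat" "\<lambda>c t. c \<in> U t + A"] by simp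
  moreover have "aff_dim A * (int (card (U t)) - 1) \<le> 2 * int (card {c \<in> C. c \<in> U t + A})"
    if "t \<in> {1..s}" for t
  proof -
    have "U t \<noteq> {}" using that assms(3) by (auto simp: U_def s_def A_def)
    then have "2 * int (card A) + aff_dim A * (int (card (U t)) - 1) \<le> 2 * int (card (U t + A))"
      unfolding add.commute[of "U t" A] using finA by (intro card_sumset_subset_ge) (auto simp: U_def)
    moreover have "card (U t + A) - card A \<le> card ((U t + A) - A)"
      using finA by (rule diff_card_le_card_Diff)
    moreover have "U t + A \<subseteq> A + A" by (intro set_plus_mono2) (auto simp: U_def)
    then have "(U t + A) - A \<subseteq> {c \<in> C. c \<in> U t + A}" by (auto simp: C_def)
    then have "card ((U t + A) - A) \<le> card {c \<in> C. c \<in> U t + A}"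
      using finC by (intro card_mono) simp_all
    ultimately show ?thesis by linarith
  qed
  then have "(\<Sum>t=1..s. aff_dim A * (int (card (U t)) - 1)) \<le> (\<Sum>t=1..s. 2 * int (card {c \<in> C. c \<in> U t + A}))"
    by (intro sum_mono) auto
  moreover from calculation have "(\<Sum>t=1..s. int (card {c \<in> C. c \<in> U t + A})) \<le> int (card {z \<in> X + g ` A. f z \<notin> A})"
    using le by (simp flip: of_nat_sum)
  ultimately have main: "aff_dim A * (int (\<Sum>t=1..s. card (U t)) - int s) \<le> 2 * int (card {z \<in> X + g ` A. f z \<notin> A})"
    by (simp flip: sum_distrib_left add: sum_subtractf)
  have "(\<Sum>t=1..s. card (U t)) = (\<Sum>a\<in>A. card {t \<in> {1..s}. t \<le> \<mu> a})"
    using sum.swap_restrict[OF _ finA, of "{1..s}" "\<lambda>_ _. 1::nat" "\<lambda>t a. t \<le> \<mu> a"] by (simp add: U_def)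
  also have "\<dots> = (\<Sum>a\<in>A. \<mu> a)"
  proof (rule sum.cong[OF refl])
    fix a assume "a \<in> A"
    then have "{t \<in> {1..s}. t \<le> \<mu> a} = {1..\<mu> a}" using \<mu>s by force
    then show "card {t \<in> {1..s}. t \<le> \<mu> a} = \<mu> a" by simp
  qed
  also have "\<dots> = card X"
    using sum.image_gen[OF assms(1), of "\<lambda>_. 1::nat" f] by (simp add: \<mu>_def A_def)
  finally show ?thesis using main by (simp add: A_def s_def \<mu>_def)
qed

section \<open>Choosing the summand\<close>

text \<open>The projection onto the orthogonal complement serves as quotient map: its fibres are the
  cosets of \<open>V\<close>.\<close>

lemma ex_linear_projection:
  fixes V :: "'a::euclidean_space set"
  assumes "subspace V"
  obtains f :: "'a \<Rightarrow> 'a" where "linear f" "\<And>x. f x = 0 \<longleftrightarrow> x \<in> V" "\<And>x. x - f x \<in> V"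
proof -
  obtain B where B: "B \<subseteq> V" "pairwise orthogonal B" "\<And>x. x \<in> B \<Longrightarrow> norm x = 1"
    "independent B" "span B = V"
    using orthonormal_basis_subspace[OF assms] by metis
  have finB: "finite B" using B(4) by (rule independent_imp_finite)
  define f where "f x = x - (\<Sum>b\<in>B. (x \<bullet> b) *\<^sub>R b)" for x
  have sum: "(\<Sum>b\<in>B. (x \<bullet> b) *\<^sub>R b) \<in> V" for x
    using B(1) assms by (intro subspace_sum subspace_scale) auto
  show ?thesis
  proof
    show "linear f" unfolding f_def
      by (intro linearI)
        (simp_all add: inner_add_left scaleR_add_left sum.distrib scaleR_right.sum scaleR_diff_right)
    show "x - f x \<in> V" for x using sum by (simp add: f_def)
    show "f x = 0 \<longleftrightarrow> x \<in> V" for x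
      using sum[of x] orthonormal_basis_expand[OF B(2,3), of x] finB B(5) by (auto simp: f_def)
  qed
qed

lemma dim_Un_le: "dim (S \<union> T) \<le> dim S + dim (T :: 'a::euclidean_space set)"
proof -
  obtain B C where B: "independent B" "S \<subseteq> span B" "card B = dim S"
    and C: "independent C" "T \<subseteq> span C" "card C = dim T"
    using basis_exists[of S] basis_exists[of T] by metis
  have "finite (B \<union> C)" using B C by (auto dest: independent_imp_finite)
  moreover have "S \<union> T \<subseteq> span (B \<union> C)"
    using B(2) C(2) span_mono[of B "B \<union> C"] span_mono[of C "B \<union> C"] by auto
  ultimately have "dim (S \<union> T) \<le> card (B \<union> C)" by (intro dim_le_card)
  then show ?thesis using card_Un_le[of B C] B C by simp
qed

text \<open>Let \<open>A\<close> be the set of classes modulo \<open>span T\<close>. If there are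
  more than \<open>N\<close>, representatives of \<open>N\<close> of them translate the class of
  \<open>x0\<close> into disjoint copies. Otherwise one representative per class is affordable, and
  the sums outside \<open>X + span T\<close> are counted in the quotient.\<close>

lemma ex_small_completion:
  fixes X T :: "'a::euclidean_space set"
  assumes X: "finite X" "0 \<in> X" "x0 \<in> X" and "T \<subseteq> X"
    and max: "\<And>z. z \<in> X \<Longrightarrow> card {x \<in> X. x - z \<in> span T} \<le> card {x \<in> X. x - x0 \<in> span T}"
  defines "s \<equiv> card {x \<in> X. x - x0 \<in> span T}"
  shows "\<exists>Y\<subseteq>X. card Y \<le> N \<and> (N * s \<le> card (X + Y) \<or>
    2 * int (card (X + T)) + (int (dim X) - int (dim T)) * (int (card X) - int s)
      \<le> 2 * int (card (X + (T \<union> Y))))"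
proof -
  obtain f :: "'a \<Rightarrow> 'a" where f: "linear f" "\<And>x. f x = 0 \<longleftrightarrow> x \<in> span T" "\<And>x. x - f x \<in> span T"
    using ex_linear_projection[OF subspace_span[of T]] by metis
  have f_eq: "f x = f y \<longleftrightarrow> x - y \<in> span T" for x y
    using f(2)[of "x - y"] by (simp add: linear_diff[OF f(1)])
  define A where "A = f ` X"
  define g where "g = inv_into X f"
  have g: "g a \<in> X" "f (g a) = a" if "a \<in> A" for a
    using that by (auto simp: g_def A_def inv_into_into f_inv_into_f)
  have finA: "finite A" using X by (simp add: A_def)
  have s: "s = card {x \<in> X. f x = f x0}" by (simp add: s_def f_eq)
  show ?thesis
  proof (cases "card A \<le> N")
    case True
    have sub: "g ` A \<subseteq> X" using g by auto
    have "card (g ` A) \<le> N" using card_image_le[OF finA, of g] True by simp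
    have finT: "finite T" using assms(4) X(1) by (rule finite_subset)
    let ?Z = "{z \<in> X + g ` A. f z \<notin> A}"
    have fin: "finite (X + (T \<union> g ` A))" "finite (X + T)" "finite ?Z"
      using X finT finA by (auto simp: finite_set_plus)
    have new: "aff_dim A * (int (card X) - int s) \<le> 2 * int (card ?Z)"
      unfolding A_def s using g max
      by (intro card_new_classes_ge[OF X(1) f(1) X(3)]) (auto simp: A_def simp flip: f_eq)
    \<comment> \<open>This bounds \<open>dim A\<close> below by \<open>dim X - dim T\<close>;
      because \<open>0\<close> lies in \<open>A\<close>, its affine dimension is the same.\<close>
    have "X \<subseteq> span (span T \<union> A)"
    proof
      fix x assume "x \<in> X"
      then have "(x - f x) + f x \<in> span (span T \<union> A)"
        using f(3)[of x] by (intro span_add) (auto simp: A_def intro: span_base)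
      then show "x \<in> span (span T \<union> A)" by simp
    qed
    then have "dim X \<le> dim (span T \<union> A)" by (metis dim_span dim_subset)
    also have "\<dots> \<le> dim T + dim A" using dim_Un_le[of "span T" A] by simp
    finally have "int (dim X) - int (dim T) \<le> int (dim A)" by simp
    also have "int (dim A) = aff_dim A"
    proof -
      have "0 \<in> A" using X(2) linear_0[OF f(1)] by (force simp: A_def)
      then show ?thesis by (simp add: aff_dim_zero hull_inc)
    qed
    finally have dim: "int (dim X) - int (dim T) \<le> aff_dim A" .
    have "s \<le> card X" unfolding s_def using X(1) by (intro card_mono) auto
    then have "(int (dim X) - int (dim T)) * (int (card X) - int s) \<le> 2 * int (card ?Z)"
      using mult_right_mono[OF dim, of "int (card X) - int s"] new by simp
    moreover have "card (X + T) + card ?Z \<le> card (X + (T \<union> g ` A))"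
    proof -
      have "f z \<in> A" if "z \<in> X + T" for z
      proof -
        obtain x t where "x \<in> X" "t \<in> T" "z = x + t"
          using \<open>z \<in> X + T\<close> by (auto elim: set_plus_elim)
        moreover from this have "f t = 0" by (simp add: f(2) span_base)
        ultimately show ?thesis by (simp add: A_def linear_add[OF f(1)])
      qed
      then have "(X + T) \<inter> ?Z = {}" by auto
      then have "card (X + T) + card ?Z = card ((X + T) \<union> ?Z)"
        using fin by (simp add: card_Un_disjoint)
      moreover have "(X + T) \<union> ?Z \<subseteq> X + (T \<union> g ` A)" by (auto elim!: set_plus_elim)
      ultimately show ?thesis using card_mono[OF fin(1)] by metis
    qed
    ultimately show ?thesis
      using sub \<open>card (g ` A) \<le> N\<close> by (intro exI[of _ "g ` A"]) auto
  next
    case False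
    then obtain A0 where A0: "A0 \<subseteq> A" "card A0 = N"
      by (meson nat_le_linear obtain_subset_with_card_n)
    have finA0: "finite A0" using A0 finA finite_subset by blast
    have sub: "g ` A0 \<subseteq> X" using g A0 by auto
    let ?C = "{x \<in> X. f x = f x0}"
    have "inj_on (\<lambda>(y, c). y + g c) (?C \<times> A0)"
    proof (rule inj_onI, clarsimp)
      fix y c y' c'
      assume *: "f y = f x0" "f y' = f x0" "c \<in> A0" "c' \<in> A0" "y + g c = y' + g c'"
      have "f (y + g c) = f x0 + c" "f (y' + g c') = f x0 + c'"
        using *(1-4) A0 g by (auto simp: linear_add[OF f(1)])
      then have "c = c'" using *(5) by simp
      then show "y = y' \<and> c = c'" using *(5) by simp
    qed
    then have "N * s = card ((\<lambda>(y, c). y + g c) ` (?C \<times> A0))"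
      using A0 by (simp add: card_image card_cartesian_product s)
    also have "\<dots> \<le> card (X + g ` A0)"
      using X finA0 by (intro card_mono) (auto simp: finite_set_plus)
    finally have "N * s \<le> card (X + g ` A0)" .
    moreover have "card (g ` A0) \<le> N" using card_image_le[OF finA0, of g] A0 by simp
    ultimately show ?thesis using sub by blast
  qed
qed

section \<open>The greedy construction\<close>

lemma card_sumset_insert_ge:
  fixes X T :: "'a::euclidean_space set"
  assumes "finite X" "finite T"
  shows "card (X + T) + card {y \<in> X. \<forall>x\<in>X. y + b - x \<notin> span T} \<le> card (X + insert b T)"
proof -
  let ?F = "{y \<in> X. \<forall>x\<in>X. y + b - x \<notin> span T}"
  have "y + b \<noteq> x + t" if "y \<in> ?F" "x \<in> X" "t \<in> T" for y x t
  proof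
    assume "y + b = x + t"
    then have "y + b - x = t" by simp
    then show False using that span_base[of t T] by auto
  qed
  then have "(X + T) \<inter> (\<lambda>y. y + b) ` ?F = {}" by (fastforce elim!: set_plus_elim)
  then have "card (X + T) + card ((\<lambda>y. y + b) ` ?F) = card ((X + T) \<union> (\<lambda>y. y + b) ` ?F)"
    using assms by (simp add: card_Un_disjoint finite_set_plus)
  also have "\<dots> \<le> card (X + insert b T)"
    using assms by (intro card_mono) (auto simp: finite_set_plus elim!: set_plus_elim)
  finally show ?thesis by (simp add: card_image)
qed

text \<open>The greedy process is replaced by a largest set \<open>T\<close> that is both
  \<open>Good\<close> and \<open>Light\<close>. Either \<open>dim T\<close> is already close to
  \<open>r\<close>, or a one-point extension \<open>S\<close> is \<open>Good\<close> but not
  \<open>Light\<close>, and the resulting heavy class allows a completion.\<close>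

lemma ex_small_summand_origin:
  fixes X :: "'a::euclidean_space set" and \<gamma> :: real
  assumes X: "finite X" "0 \<in> X" and r: "r \<le> dim X"
    and \<gamma>: "0 < \<gamma>" "\<gamma> < 1/5" "1 < real r * \<gamma>^3"
  shows "\<exists>T\<subseteq>X. real (card T) \<le> 4 * (real r + 1) / \<gamma> \<and>
    (1 - 5 * \<gamma>) * ((real r + 1) * real (card X) / 2) \<le> real (card (X + T))"
proof -
  define n where "n = real (card X)"
  \<comment> \<open>Chosen so that \<open>4 / \<gamma>\<close> disjoint copies of a class of
    \<open>\<theta> * n\<close> points make up \<open>n / 2\<close>.\<close>
  define \<theta> where "\<theta> = \<gamma> / 8"
  define Good where "Good T \<longleftrightarrow> T \<subseteq> X \<and> 0 \<in> T \<and> card T = dim T + 1 \<and> dim T \<le> r \<and>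
    n * (2 + real (dim T) * (1 - \<theta>)) \<le> 2 * real (card (X + T))" for T
  define Light where "Light T \<longleftrightarrow> (\<forall>z\<in>X. real (card {x \<in> X. x - z \<in> span T}) \<le> \<theta> * n)" for T
  have "dim X \<le> card X" using X by (simp add: dim_le_card')
  then have rn: "real r \<le> n" using r by (simp add: n_def)
  have r\<gamma>2: "1 / \<gamma>^2 < real r * \<gamma>"
    using \<gamma> by (simp add: pos_divide_less_eq power3_eq_cube power2_eq_square algebra_simps)
  have "25 \<le> 1 / \<gamma>^2"
    using \<gamma> power_mono[of \<gamma> "1/5" 2] by (simp add: field_simps power2_eq_square)
  then have r\<gamma>: "25 < real r * \<gamma>" using r\<gamma>2 by linarith
  moreover have "real r * \<gamma> \<le> n * \<gamma>" using rn \<gamma> by (intro mult_right_mono) auto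
  ultimately have "25 < n * \<gamma>" by linarith
  \<comment> \<open>Modulo \<open>span {0}\<close> the classes are single points, so this makes the
    starting set \<open>{0}\<close> light.\<close>
  then have "1 \<le> \<theta> * n" by (simp add: \<theta>_def mult.commute)
  have n: "n > 0" using \<open>25 < n * \<gamma>\<close> \<gamma> zero_less_mult_pos2[of n \<gamma>] by linarith
  have "X + {0} = X" by (simp add: set_plus_def)
  then have "Good {0}" using X by (simp add: Good_def n_def)
  moreover have "Light {0}"
  proof -
    have "{x \<in> X. x - z \<in> span {0}} = {z}" if "z \<in> X" for z using that by auto
    then show ?thesis using \<open>1 \<le> \<theta> * n\<close> by (simp add: Light_def)
  qed
  moreover have "finite {T. Good T \<and> Light T}"
    using X(1) by (rule_tac finite_subset[of _ "Pow X"]) (auto simp: Good_def)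
  ultimately obtain T where T: "Good T" "Light T"
    and T_max: "\<And>S. Good S \<Longrightarrow> Light S \<Longrightarrow> card S \<le> card T"
    using ex_is_arg_min_if_finite[of "{T. Good T \<and> Light T}" "\<lambda>S. - int (card S)"]
    by (auto simp: is_arg_min_linorder)
  have finT: "finite T" using T X by (auto simp: Good_def intro: finite_subset)
  have four: "real r + 1 \<le> 4 * (real r + 1) / \<gamma>"
    using \<gamma> mult_left_mono[of \<gamma> 4 "real r + 1"] by (simp add: pos_le_divide_eq algebra_simps)
  show ?thesis
  proof (cases "real (dim T) + 1 / \<gamma>^2 + 2 \<le> real r")
    case False
    \<comment> \<open>As \<open>1 / \<gamma>^2 < r * \<gamma>\<close>, the set \<open>T\<close>
      itself has dimension above \<open>r * (1 - \<gamma>) - 2\<close>.\<close>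
    have "(1 - 5 * \<gamma>) * (real r + 1) \<le> 2 + real (dim T) * (1 - \<theta>)"
    proof -
      have "real r * (1 - \<gamma>) - 2 \<le> real (dim T)" using False r\<gamma>2 by (simp add: algebra_simps)
      then have "(real r * (1 - \<gamma>) - 2) * (1 - \<gamma>) \<le> real (dim T) * (1 - \<theta>)"
        using \<gamma> by (intro mult_mono) (auto simp: \<theta>_def)
      moreover have "(real r * (1 - \<gamma>) - 2) * (1 - \<gamma>) + 2 = real r * (1 - 2 * \<gamma>) + real r * \<gamma>^2 + 2 * \<gamma>"
        by (simp add: algebra_simps power2_eq_square)
      moreover have "0 \<le> real r * \<gamma>^2" by simp
      moreover have "(1 - 5 * \<gamma>) * (real r + 1) = real r * (1 - 2 * \<gamma>) - 3 * (real r * \<gamma>) + 1 - 5 * \<gamma>"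
        by (simp add: algebra_simps)
      ultimately show ?thesis using r\<gamma> \<gamma> by linarith
    qed
    then have "n * ((1 - 5 * \<gamma>) * (real r + 1)) \<le> n * (2 + real (dim T) * (1 - \<theta>))"
      using n by (intro mult_left_mono) auto
    then show ?thesis using T(1) four
      by (intro exI[of _ T]) (force simp: Good_def n_def algebra_simps)
  next
    case True
    have light: "real (card {x \<in> X. x - z \<in> span T}) \<le> \<theta> * n" if "z \<in> X" for z
      using T(2) that by (simp add: Light_def)
    have \<theta>n: "0 \<le> \<theta> * n" "\<theta> * n < 2 * \<gamma> * n"
      using \<gamma> n by (auto simp: \<theta>_def)
    obtain W where W: "subspace W" "span T \<subseteq> W"
      "real (dim W) \<le> real (dim (span T)) + real (card X)^2 / (2 * \<gamma> * n * (2 * \<gamma> * n - \<theta> * n))"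
      "\<And>b z. \<lbrakk>b \<in> X - W; z \<in> X\<rbrakk> \<Longrightarrow> real (card {x \<in> X. x - z \<in> span (insert b (span T))}) \<le> 2 * \<gamma> * n"
      using few_heavy_extensions[OF X(1) subspace_span \<theta>n light] by blast
    \<comment> \<open>So avoiding all heavy extensions costs at most \<open>1 / \<gamma>^2\<close>
      dimensions, and the two needed for the half-fresh point \<open>b\<close> remain.\<close>
    have "n^2 / (2 * \<gamma> * n * (2 * \<gamma> * n - \<theta> * n)) \<le> 1 / \<gamma>^2"
    proof -
      have "2 * \<gamma> * n * (2 * \<gamma> * n - \<theta> * n) = n^2 * (\<gamma>^2 * (15/4))"
        by (simp add: \<theta>_def algebra_simps power2_eq_square)
      then have "n^2 / (2 * \<gamma> * n * (2 * \<gamma> * n - \<theta> * n)) = (1 / \<gamma>^2) * (4/15)"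
        using n by (simp only:) simp
      also have "\<dots> \<le> (1 / \<gamma>^2) * 1" by (intro mult_left_mono) simp_all
      finally show ?thesis by (simp only: mult_1_right)
    qed
    then have "real (dim W + 2) \<le> real r" using W(3) True unfolding n_def dim_span by linarith
    then have "dim W + 2 \<le> dim X" using r by linarith
    then obtain b where b: "b \<in> X - W"
      "card X \<le> card (X \<inter> span T) + 2 * card {y \<in> X. \<forall>x\<in>X. y + b - x \<notin> span T}"
      using ex_half_fresh[OF X(1) subspace_span W(1,2)] by blast
    define S where "S = insert b T"
    have bT: "b \<notin> span T" using b W by auto
    then have "b \<notin> T" using span_base[of b T] by auto
    have dimS: "dim S = dim T + 1" using bT by (simp add: S_def dim_insert)
    have cardS: "card S = dim S + 1" using T(1) finT \<open>b \<notin> T\<close> dimS by (simp add: S_def Good_def)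
    have S_X: "S \<subseteq> X" using T(1) b by (auto simp: S_def Good_def)
    have "1 / \<gamma>^2 \<ge> 0" by simp
    then have dimr: "dim S \<le> r" using True dimS by linarith
    have "X \<inter> span T = {x \<in> X. x - 0 \<in> span T}" by auto
    then have "real (card (X \<inter> span T)) \<le> \<theta> * n" using light[OF X(2)] by simp
    moreover have "card (X + T) + card {y \<in> X. \<forall>x\<in>X. y + b - x \<notin> span T} \<le> card (X + S)"
      using X(1) finT unfolding S_def by (rule card_sumset_insert_ge)
    ultimately have "2 * real (card (X + T)) + (n - \<theta> * n) \<le> 2 * real (card (X + S))"
      using b(2) unfolding n_def by linarith
    then have growth: "n * (2 + real (dim S) * (1 - \<theta>)) \<le> 2 * real (card (X + S))"
      using T(1) by (simp add: Good_def dimS algebra_simps)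
    have "Good S" using growth S_X T(1) cardS dimr by (simp add: Good_def S_def)
    then have "\<not> Light S" using T_max[of S] cardS dimS T(1) by (auto simp: Good_def)
    have "span (insert b (span T)) = span S"
      unfolding S_def using span_mono[of T "insert b T"] span_superset[of T]
      by (intro equalityI span_minimal span_mono) (auto intro: span_base)
    then have heavy: "real (card {x \<in> X. x - z \<in> span S}) \<le> 2 * \<gamma> * n" if "z \<in> X" for z
      using W(4)[OF b(1) that] by simp
    obtain x0 where x0: "x0 \<in> X"
      "\<And>z. z \<in> X \<Longrightarrow> card {x \<in> X. x - z \<in> span S} \<le> card {x \<in> X. x - x0 \<in> span S}"
      using ex_is_arg_min_if_finite[of X "\<lambda>z. - int (card {x \<in> X. x - z \<in> span S})"] X
      by (auto simp: is_arg_min_linorder)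
    define s where "s = card {x \<in> X. x - x0 \<in> span S}"
    have s: "\<theta> * n < real s" "real s \<le> 2 * \<gamma> * n"
      using \<open>\<not> Light S\<close> x0 heavy[OF x0(1)] by (force simp: Light_def s_def)+
    \<comment> \<open>The full budget \<open>4 * (r + 1) / \<gamma>\<close> minus
      \<open>r + 1\<close> places reserved for \<open>S\<close>.\<close>
    define N where "N = nat \<lfloor>(4 / \<gamma> - 1) * (real r + 1)\<rfloor>"
    have "0 \<le> (4 / \<gamma> - 1) * (real r + 1)"
      using \<gamma> by (intro mult_nonneg_nonneg) (simp_all add: pos_le_divide_eq)
    then have N: "real N \<le> (4 / \<gamma> - 1) * (real r + 1)" "(4 / \<gamma> - 1) * (real r + 1) - 1 \<le> real N"
      unfolding N_def by linarith+
    obtain Y where Y: "Y \<subseteq> X" "card Y \<le> N"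
      "N * s \<le> card (X + Y) \<or>
       2 * int (card (X + S)) + (int (dim X) - int (dim S)) * (int (card X) - int s)
         \<le> 2 * int (card (X + (S \<union> Y)))"
      using ex_small_completion[OF X x0(1) S_X x0(2), of N] unfolding s_def by blast
    have sum: "(4 / \<gamma> - 1) * (real r + 1) + (real r + 1) = 4 * (real r + 1) / \<gamma>"
      by (simp add: algebra_simps)
    from Y(3) show ?thesis
    proof
      assume "N * s \<le> card (X + Y)"
      then have "real N * real s \<le> real (card (X + Y))" by (metis of_nat_le_iff of_nat_mult)
      moreover have "((4 / \<gamma> - 1) * (real r + 1) - 1) * (\<theta> * n) \<le> real N * real s"
        using N s \<theta>n by (intro mult_mono) auto
      \<comment> \<open>The reserved places and the rounding in \<open>N\<close> together cost
        \<open>\<gamma> * (r + 2) / 8\<close>.\<close>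
      moreover have "((4 / \<gamma> - 1) * (real r + 1) - 1) * (\<theta> * n)
          = n * ((real r + 1) / 2 - \<gamma> * (real r + 2) / 8)"
        using \<gamma> by (simp add: \<theta>_def field_simps)
      moreover have "(1 - 5 * \<gamma>) * (real r + 1) / 2 \<le> (real r + 1) / 2 - \<gamma> * (real r + 2) / 8"
      proof -
        have "(real r + 1) / 2 - \<gamma> * (real r + 2) / 8 - (1 - 5 * \<gamma>) * (real r + 1) / 2
            = 19/8 * (real r * \<gamma>) + 9/4 * \<gamma>" by (simp add: field_simps)
        then show ?thesis using r\<gamma> \<gamma> by linarith
      qed
      then have "n * ((1 - 5 * \<gamma>) * (real r + 1) / 2) \<le> n * ((real r + 1) / 2 - \<gamma> * (real r + 2) / 8)"
        using n by (intro mult_left_mono) auto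
      ultimately have "n * ((1 - 5 * \<gamma>) * (real r + 1) / 2) \<le> real (card (X + Y))" by linarith
      then have "(1 - 5 * \<gamma>) * ((real r + 1) * n / 2) \<le> real (card (X + Y))"
        by (simp add: mult_ac)
      moreover have "real (card Y) \<le> 4 * (real r + 1) / \<gamma>" using Y(2) N sum by linarith
      ultimately show ?thesis using Y(1) unfolding n_def by blast
    next
      assume "2 * int (card (X + S)) + (int (dim X) - int (dim S)) * (int (card X) - int s)
         \<le> 2 * int (card (X + (S \<union> Y)))"
      then have "real_of_int (2 * int (card (X + S)) + (int (dim X) - int (dim S)) * (int (card X) - int s))
         \<le> real_of_int (2 * int (card (X + (S \<union> Y))))" by (rule of_int_le_iff[THEN iffD2])
      then have "2 * real (card (X + S)) + (real (dim X) - real (dim S)) * (n - real s)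
         \<le> 2 * real (card (X + (S \<union> Y)))" by (simp add: n_def)
      \<comment> \<open>The \<open>dim S\<close> steps already made and the \<open>r - dim S\<close>
        missing ones are both counted at rate \<open>1 - 2 * \<gamma>\<close>, so
        \<open>dim S\<close> cancels.\<close>
      moreover have "(real r - real (dim S)) * (n - 2 * \<gamma> * n) \<le> (real (dim X) - real (dim S)) * (n - real s)"
        using r dimr s n \<gamma> by (intro mult_mono) auto
      moreover have "n * (2 + real (dim S) * (1 - 2 * \<gamma>)) \<le> n * (2 + real (dim S) * (1 - \<theta>))"
        using n \<gamma> by (intro mult_left_mono add_left_mono) (auto simp: \<theta>_def)
      moreover have "n * (2 + real (dim S) * (1 - 2 * \<gamma>)) + (real r - real (dim S)) * (n - 2 * \<gamma> * n)
        = n * (2 + real r * (1 - 2 * \<gamma>))" by (simp add: algebra_simps)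
      moreover have "(1 - 5 * \<gamma>) * (real r + 1) \<le> 2 + real r * (1 - 2 * \<gamma>)"
      proof -
        have "2 + real r * (1 - 2 * \<gamma>) - (1 - 5 * \<gamma>) * (real r + 1) = 1 + 5 * \<gamma> + 3 * (real r * \<gamma>)"
          by (simp add: algebra_simps)
        then show ?thesis using r\<gamma> \<gamma> by linarith
      qed
      then have "n * ((1 - 5 * \<gamma>) * (real r + 1)) \<le> n * (2 + real r * (1 - 2 * \<gamma>))"
        using n by (intro mult_left_mono) auto
      ultimately have "n * ((1 - 5 * \<gamma>) * (real r + 1)) \<le> 2 * real (card (X + (S \<union> Y)))"
        using growth by linarith
      then have "(1 - 5 * \<gamma>) * ((real r + 1) * n / 2) \<le> real (card (X + (S \<union> Y)))"
        by (simp add: algebra_simps)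
      moreover have "real (card (S \<union> Y)) \<le> 4 * (real r + 1) / \<gamma>"
        using card_Un_le[of S Y] Y(2) N sum cardS dimr by linarith
      ultimately show ?thesis using Y(1) S_X unfolding n_def by (intro exI[of _ "S \<union> Y"]) auto
    qed
  qed
qed

text \<open>For \<open>\<gamma> \<ge> 1/5\<close> or empty \<open>X\<close> the lower bound is at
  most 0 and the empty set works. Otherwise moving a point \<open>x0\<close> of \<open>X\<close> to
  the origin turns the affine rank into a linear dimension and shifts the sumset by
  \<open>x0 + x0\<close>.\<close>

theorem theorem1p3:
  fixes r :: nat and \<gamma> :: real and X :: "(real ^ 'd) set"
  assumes "r \<ge> 1"
    and "\<gamma> > real r powr (-1/3)"
    and "finite X"
    and "affine_rank X \<ge> r"
  shows "\<exists>T. T \<subseteq> X \<and> real (card T) \<le> 4 * (real r + 1) / \<gamma> \<and>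
    real (card (X + T)) \<ge> (1 - 5 * \<gamma>) * ((real r + 1) * real (card X) / 2)"
proof -
  have "0 < real r powr (-1/3)" using assms(1) by simp
  then have "\<gamma> > 0" using assms(2) by linarith
  show ?thesis
  proof (cases "\<gamma> < 1/5 \<and> X \<noteq> {}")
    case False
    then have "(1 - 5 * \<gamma>) * ((real r + 1) * real (card X) / 2) \<le> 0"
      by (auto intro: mult_nonpos_nonneg)
    then show ?thesis using \<open>\<gamma> > 0\<close> by (intro exI[of _ "{}"]) (auto intro: order_trans)
  next
    case True
    then obtain x0 where x0: "x0 \<in> X" by blast
    define X' where "X' = (\<lambda>x. x - x0) ` X"
    have X': "finite X'" "0 \<in> X'" using assms(3) x0 by (auto simp: X'_def)
    have "int (dim X') = aff_dim X'" using X'(2) by (simp add: aff_dim_zero hull_inc)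
    also have "\<dots> = aff_dim X" unfolding X'_def by (rule aff_dim_translation_eq_subtract)
    also have "\<dots> = int (affine_rank X)" using True by (simp add: affine_rank_eq_aff_dim)
    finally have dim: "r \<le> dim X'" using assms(4) by simp
    have "(real r powr (-1/3)) ^ 3 < \<gamma> ^ 3"
      using assms(2) \<open>0 < real r powr (-1/3)\<close> by (intro power_strict_mono) auto
    moreover have "(real r powr (-1/3)) ^ 3 = real r powr (-1)"
      using assms(1) by (subst powr_power) auto
    moreover have "real r powr (-1) = 1 / real r" using assms(1) by (intro powr_neg_one) auto
    ultimately have "1 / real r < \<gamma> ^ 3" by metis
    then have "1 < real r * \<gamma> ^ 3" using assms(1) by (simp add: field_simps)
    then obtain T where T: "T \<subseteq> X'" "real (card T) \<le> 4 * (real r + 1) / \<gamma>"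
      "(1 - 5 * \<gamma>) * ((real r + 1) * real (card X') / 2) \<le> real (card (X' + T))"
      using ex_small_summand_origin[OF X' dim] True \<open>\<gamma> > 0\<close> by blast
    define T' where "T' = (\<lambda>t. t + x0) ` T"
    have "T' \<subseteq> X" using T(1) by (auto simp: T'_def X'_def)
    moreover have "card T' = card T" by (simp add: T'_def card_image)
    moreover have "card X' = card X" by (simp add: X'_def card_image)
    moreover have "X + T' = (\<lambda>z. z + (x0 + x0)) ` (X' + T)"
    proof (intro equalityI subsetI)
      fix z assume "z \<in> X + T'"
      then obtain x t where "x \<in> X" "t \<in> T" "z = x + (t + x0)"
        by (auto simp: T'_def elim!: set_plus_elim)
      moreover from this have "(x - x0) + t \<in> X' + T" by (auto simp: X'_def)
      ultimately show "z \<in> (\<lambda>z. z + (x0 + x0)) ` (X' + T)"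
        by (intro image_eqI[of _ _ "(x - x0) + t"]) (auto simp: algebra_simps)
    next
      fix z assume "z \<in> (\<lambda>z. z + (x0 + x0)) ` (X' + T)"
      then obtain x t where *: "x \<in> X" "t \<in> T" "z = (x - x0) + t + (x0 + x0)"
        by (auto simp: X'_def elim!: set_plus_elim)
      then have "x + (t + x0) \<in> X + T'" by (auto simp: T'_def)
      then show "z \<in> X + T'" using * by (simp add: algebra_simps)
    qed
    then have "card (X + T') = card (X' + T)" by (simp add: card_image)
    ultimately show ?thesis using T by (intro exI[of _ T']) simp
  qed
qed

end
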